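(* Let $q$ be a positive integer and let $T=\{0,\infty,\pm 1,\pm 2,\pm\frac12,\dots,\pm q,\pm\frac1q\}$. For every positive integer $n$ with $n\le q^2+3q-1$, every solvable $n\times n$ RK puzzle with slope set $T$ has a unique solution.
   Context: For a positive integer $n$ let $I_n=\{1,\dots,n\}$, and for positive integers $n,m$ let $I_{n,m}=I_n\times I_m\subset\mathbb{R}^2$, viewed as lattice points in the Cartesian plane. For a slope $s\in\mathbb{Q}\cup\{\infty\}$ let $\mathscr{L}_s$ be the set of lines $\ell\subset\mathbb{R}^2$ of slope $s$ with $\ell\cap I_{n,m}\neq\emptyset$. For $\ell\in\mathscr{L}_s$ the clue polynomial is $P_{\ell,s}(X)=\sum_{(i,j)\in\ell\cap I_{n,m}}X_{i,j}$, a linear polynomial in the $nm$ variables $X_{i,j}$, $(i,j)\in I_{n,m}$. For a finite set $T\subset\mathbb{Q}\cup\{\infty\}$, an $n\times m$ RK puzzle with slope set $T$ is a system of linear equations consisting of exactly one equation $P_{\ell,t}(X)=c_{\ell,t}$ for every $t\in T$ and every $\ell\in\mathscr{L}_t$, where the constants $c_{\ell,t}\in\mathbb{R}$ are arbitrary. A solution of the puzzle is a real solution $(X_{i,j})$ of this system; the puzzle is solvable if it has at least one solution. *)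

theory Defs
  imports Complex_Main "HOL-Library.FuncSet"
begin

datatype slope = Finite_Slope rat | Infinite_Slope

definition grid :: "nat \<Rightarrow> nat \<Rightarrow> (nat \<times> nat) set" where
  "grid n m = {1..n} \<times> {1..m}"

definition lattice_point :: "nat \<times> nat \<Rightarrow> real \<times> real" where
  "lattice_point p = (real (fst p), real (snd p))"

fun lines_of_slope :: "slope \<Rightarrow> (real \<times> real) set set" where
  "lines_of_slope (Finite_Slope s) = {{(x, y). y = of_rat s * x + b} | b. True}"
| "lines_of_slope Infinite_Slope = {{(x, y). x = a} | a. True}"

definition grid_lines :: "nat \<Rightarrow> nat \<Rightarrow> slope \<Rightarrow> (real \<times> real) set set" where
  "grid_lines n m s = {l \<in> lines_of_slope s. l \<inter> lattice_point ` grid n m \<noteq> {}}"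

(* The clue polynomial is a homogeneous linear polynomial in the variables X (i, j);
   it is represented by the linear form that it induces on assignments X. *)
definition clue_poly ::
  "nat \<Rightarrow> nat \<Rightarrow> (real \<times> real) set \<Rightarrow> (nat \<times> nat \<Rightarrow> real) \<Rightarrow> real" where
  "clue_poly n m l X = (\<Sum>p | p \<in> grid n m \<and> lattice_point p \<in> l. X p)"

(* A puzzle of size n x m with slope set T is given by its constants c t l. Only the values with
   t in T and l in grid_lines n m t enter the system. The unknowns are indexed by the grid, so
   a solution is required to be extensional: outside the grid it has the value undefined. *)
definition rk_solution ::
  "nat \<Rightarrow> nat \<Rightarrow> slope set \<Rightarrow> (slope \<Rightarrow> (real \<times> real) set \<Rightarrow> real) \<Rightarrow> (nat \<times> nat \<Rightarrow> real) \<Rightarrow> bool" where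
  "rk_solution n m T c X \<longleftrightarrow>
     X \<in> grid n m \<rightarrow>\<^sub>E UNIV \<and>
     (\<forall>t\<in>T. \<forall>l\<in>grid_lines n m t. clue_poly n m l X = c t l)"

definition rk_solvable ::
  "nat \<Rightarrow> nat \<Rightarrow> slope set \<Rightarrow> (slope \<Rightarrow> (real \<times> real) set \<Rightarrow> real) \<Rightarrow> bool" where
  "rk_solvable n m T c \<longleftrightarrow> (\<exists>X. rk_solution n m T c X)"

definition slopes_upto :: "nat \<Rightarrow> slope set" where
  "slopes_upto q = {Finite_Slope 0, Infinite_Slope} \<union>
     (\<Union>k\<in>{1..q}. {Finite_Slope (of_nat k), Finite_Slope (- of_nat k),
                   Finite_Slope (1 / of_nat k), Finite_Slope (- (1 / of_nat k))})"

end

theory Submission imports Defs begin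

text \<open>
  The difference \<open>f\<close> of two solutions has vanishing sums along all lines with slopes in \<open>T\<close>. Fix a
  real \<open>w > 1\<close> and consider the polynomial \<open>F z = (\<Sum>(i, j). f (i, j) * w ^ j * z ^ i)\<close>, of degree at
  most \<open>n\<close> and with \<open>F 0 = 0\<close>. If \<open>b / a\<close> is a slope in lowest terms and \<open>z ^ a * w powi b = 1\<close>, then
  \<open>z ^ i * w ^ j\<close> is constant along each line of slope \<open>b / a\<close>, so \<open>F z = 0\<close>. This gives \<open>a\<close> complex
  roots for each slope; as their moduli are \<open>w powr (- b / a)\<close>, different slopes give different roots.
  Hence \<open>F = 0\<close> as soon as the denominators of the slopes add up to at least \<open>n\<close>, and for \<open>T\<close> they add
  up to \<open>q\<^sup>2 + 3 * q - 1\<close>. Letting \<open>w\<close> vary, \<open>f = 0\<close>.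
\<close>

section \<open>Rational slopes in lowest terms\<close>

definition numer :: "rat \<Rightarrow> int" where "numer s = fst (quotient_of s)"

definition denom :: "rat \<Rightarrow> nat" where "denom s = nat (snd (quotient_of s))"

lemma denom_pos: "denom s > 0"
  using quotient_of_denom_pos'[of s] by (simp add: denom_def)

lemma coprime_numer_denom: "coprime (numer s) (int (denom s))"
  using quotient_of_coprime[of s "numer s" "snd (quotient_of s)"] quotient_of_denom_pos'[of s]
  by (simp add: numer_def denom_def)

lemma rat_eq_numer_denom: "s = of_int (numer s) / of_nat (denom s)"
proof -
  have "s = of_int (fst (quotient_of s)) / of_int (snd (quotient_of s))"
    by (rule quotient_of_div) simp
  then show ?thesis
    using quotient_of_denom_pos'[of s] by (simp add: numer_def denom_def)
qed

lemma denom_eqI: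
  assumes "s = of_int a / of_nat b" "b > 0" "coprime a (int b)"
  shows "denom s = b"
proof -
  have "s = Fract a (int b)"
    using assms by (simp add: Fract_of_int_quotient)
  then show ?thesis
    using assms by (simp add: quotient_of_Fract denom_def)
qed

subsection \<open>Roots attached to a slope\<close>

text \<open>For \<open>w > 0\<close> this is the equation \<open>z ^ a * w powi b = 1\<close> for
  the slope \<open>b / a\<close>, solved for the power of \<open>z\<close> so that
  \<open>card_nth_roots\<close> counts its solutions.\<close>

definition slope_roots :: "real \<Rightarrow> rat \<Rightarrow> complex set" where
  "slope_roots w s = {z. z ^ denom s = of_real (w powi (- numer s))}"

lemma card_slope_roots:
  assumes "w > 0"
  shows "card (slope_roots w s) = denom s"
  unfolding slope_roots_def using assms by (intro card_nth_roots denom_pos) auto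

lemma finite_slope_roots:
  assumes "w > 0"
  shows "finite (slope_roots w s)"
  using card_slope_roots[OF assms, of s] denom_pos[of s] card_ge_0_finite by metis

lemma zero_notin_slope_roots:
  assumes "w > 0"
  shows "0 \<notin> slope_roots w s"
  using assms denom_pos[of s] by (simp add: slope_roots_def zero_power del: of_real_power_int)

text \<open>Either membership expresses \<open>z ^ (denom s * denom t)\<close> as an integer power
  of \<open>w\<close>. As \<open>w > 1\<close>, the two exponents agree, and this is the equality of
  the two fractions after cross-multiplication.\<close>

lemma slope_roots_disjoint:
  assumes w: "w > 1" and z: "z \<in> slope_roots w s" "z \<in> slope_roots w t"
  shows "s = t"
proof -
  have "complex_of_real (w powi (- numer s * int (denom t))) = z ^ (denom s * denom t)"
    using z by (simp add: slope_roots_def power_mult power_int_mult del: mult_minus_left)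
  also have "\<dots> = complex_of_real (w powi (- numer t * int (denom s)))"
    using z by (subst mult.commute) (simp add: slope_roots_def power_mult power_int_mult del: mult_minus_left)
  finally have "w powi (- numer s * int (denom t)) = w powi (- numer t * int (denom s))"
    using of_real_eq_iff by blast
  then have "- numer s * int (denom t) = - numer t * int (denom s)"
    using power_int_strict_increasing[OF _ w] by (metis linorder_neqE less_irrefl)
  then have "rat_of_int (numer s) * of_nat (denom t) = of_int (numer t) * of_nat (denom s)"
    by (metis minus_mult_left neg_equal_iff_equal of_int_mult of_int_of_nat_eq)
  then show ?thesis
    using denom_pos[of s] denom_pos[of t]
    by (subst rat_eq_numer_denom[of s], subst rat_eq_numer_denom[of t]) (simp add: field_simps)
qed

text \<open>Since the slope \<open>b / a\<close> is in lowest terms, two lattice points on a line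
  differ by an integer multiple \<open>k\<close> of \<open>(a, b)\<close>. The monomial thus changes
  by the factor \<open>(z powi a * w powi b) powi k = 1\<close>. As \<open>k\<close> may be
  negative, the computation uses \<open>powi\<close> and \<open>z \<noteq> 0\<close>.\<close>

lemma monomial_constant_on_line:
  fixes i j i' j' :: nat
  assumes w: "w > 0" and z: "z \<in> slope_roots w s"
    and line: "rat_of_nat j - s * of_nat i = of_nat j' - s * of_nat i'"
  shows "z ^ i * of_real w ^ j = z ^ i' * of_real w ^ j'"
proof -
  let ?a = "int (denom s)" and ?b = "numer s" and ?W = "complex_of_real w"
  have a: "?a > 0" using denom_pos by simp
  have z0: "z \<noteq> 0" using z zero_notin_slope_roots[OF w] by auto
  have "rat_of_int ((int j - int j') * ?a) = of_int (?b * (int i - int i'))"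
    using line denom_pos[of s]
    by (subst (asm) (1 2) rat_eq_numer_denom) (simp add: field_simps)
  then have eq: "(int j - int j') * ?a = ?b * (int i - int i')"
    using of_int_eq_iff by blast
  then have "?a dvd ?b * (int i - int i')" by (metis dvd_triv_right)
  then have "?a dvd int i - int i'"
    using coprime_numer_denom by (simp add: coprime_dvd_mult_right_iff coprime_commute)
  then obtain k where k: "int i - int i' = ?a * k" by (elim dvdE)
  with eq a have l: "int j - int j' = ?b * k" by simp
  have unit: "z powi ?a * ?W powi ?b = 1"
    using z w by (simp add: slope_roots_def power_int_minus)
  have "z ^ i * ?W ^ j = z powi (int i' + ?a * k) * ?W powi (int j' + ?b * k)"
    using k l by (smt (verit) power_int_of_nat)
  also have "\<dots> = z ^ i' * ?W ^ j' * (z powi ?a * ?W powi ?b) powi k"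
    using z0 w by (simp add: power_int_add power_int_mult power_int_mult_distrib)
  finally show ?thesis by (simp only: unit power_int_1_left mult_1_right)
qed

subsection \<open>Vanishing line sums\<close>

text \<open>Group the points by the intercept \<open>?h\<close> of their line. On each group the
  monomial is a constant, which factors out and leaves a vanishing line sum.\<close>

lemma line_sums_zero_imp_root:
  fixes f :: "nat \<times> nat \<Rightarrow> real"
  assumes w: "w > 0" and z: "z \<in> slope_roots w s" and "finite A"
    and sums: "\<And>b. (\<Sum>p | p \<in> A \<and> rat_of_nat (snd p) - s * of_nat (fst p) = b. f p) = 0"
  shows "(\<Sum>p\<in>A. of_real (f p) * (z ^ fst p * of_real w ^ snd p)) = 0"
proof -
  let ?h = "\<lambda>p. rat_of_nat (snd p) - s * of_nat (fst p)"
  let ?m = "\<lambda>p. z ^ fst p * of_real w ^ snd p"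
  have "(\<Sum>p | p \<in> A \<and> ?h p = ?h p0. of_real (f p) * ?m p) = 0" for p0 :: "nat \<times> nat"
  proof -
    have "(\<Sum>p | p \<in> A \<and> ?h p = ?h p0. of_real (f p) * ?m p)
        = (\<Sum>p | p \<in> A \<and> ?h p = ?h p0. of_real (f p) * ?m p0)"
    proof (rule sum.cong)
      fix p assume "p \<in> {p. p \<in> A \<and> ?h p = ?h p0}"
      then have "?m p = ?m p0" by (intro monomial_constant_on_line[OF w z]) simp
      then show "of_real (f p) * ?m p = of_real (f p) * ?m p0" by (simp only:)
    qed simp
    also have "\<dots> = of_real (\<Sum>p | p \<in> A \<and> ?h p = ?h p0. f p) * ?m p0"
      by (simp add: sum_distrib_right)
    finally show ?thesis by (simp add: sums)
  qed
  then have "(\<Sum>b\<in>?h ` A. \<Sum>p | p \<in> A \<and> ?h p = b. of_real (f p) * ?m p) = 0"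
    by (intro sum.neutral) blast
  then show ?thesis
    by (simp only: sum.image_gen[OF \<open>finite A\<close>, of _ ?h])
qed

lemma line_sums_zero_imp_zero:
  fixes f :: "nat \<times> nat \<Rightarrow> real"
  assumes "finite S" and n: "n \<le> (\<Sum>s\<in>S. denom s)"
    and sums: "\<And>s b. s \<in> S \<Longrightarrow>
      (\<Sum>p | p \<in> grid n m \<and> rat_of_nat (snd p) - s * of_nat (fst p) = b. f p) = 0"
    and outside: "\<And>p. p \<notin> grid n m \<Longrightarrow> f p = 0"
  shows "f p = 0"
proof -
  \<comment> \<open>\<open>c w i\<close> is the coefficient of \<open>z ^ i\<close> in
    \<open>F\<close>.\<close>
  define c where "c w i = (\<Sum>j\<le>m. f (i, j) * w ^ j)" for w i
  have c0: "c w i = 0" if w: "w > 1" and i: "i \<le> n" for w i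
  proof (rule ccontr)
    assume "c w i \<noteq> 0"
    let ?Z = "{z. (\<Sum>i\<le>n. complex_of_real (c w i) * z ^ i) = 0}"
    have fin: "finite ?Z" and card: "card ?Z \<le> n"
      using \<open>c w i \<noteq> 0\<close> i
        polyfun_rootbound[of "\<lambda>i. complex_of_real (c w i)" i n] by auto
    have F: "(\<Sum>i\<le>n. complex_of_real (c w i) * z ^ i)
        = (\<Sum>p\<in>grid n m. of_real (f p) * (z ^ fst p * of_real w ^ snd p))" for z
    proof -
      have "(\<Sum>i\<le>n. complex_of_real (c w i) * z ^ i)
          = (\<Sum>p\<in>{..n}\<times>{..m}. of_real (f p) * (z ^ fst p * of_real w ^ snd p))"
        by (simp add: c_def sum.cartesian_product' sum_distrib_left mult_ac)
      also have "\<dots> = (\<Sum>p\<in>grid n m. of_real (f p) * (z ^ fst p * of_real w ^ snd p))"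
        by (rule sum.mono_neutral_right) (auto simp: grid_def outside)
      finally show ?thesis .
    qed
    \<comment> \<open>Grid coordinates start at 1, so 0 is one more root. It raises the count to at
      least \<open>n + 1\<close>, which is why \<open>n\<close> itself may equal the sum of the
      denominators.\<close>
    have "0 \<in> ?Z" unfolding F by (auto simp: grid_def intro!: sum.neutral)
    moreover have "slope_roots w s \<subseteq> ?Z" if "s \<in> S" for s
      unfolding F using line_sums_zero_imp_root[OF _ _ _ sums[OF that]] w
      by (auto simp: grid_def)
    ultimately have "insert 0 (\<Union>s\<in>S. slope_roots w s) \<subseteq> ?Z" by auto
    then have "card (insert 0 (\<Union>s\<in>S. slope_roots w s)) \<le> n"
      using card_mono[OF fin] card by (meson le_trans)
    moreover have "card (insert 0 (\<Union>s\<in>S. slope_roots w s)) = Suc (card (\<Union>s\<in>S. slope_roots w s))"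
      using w \<open>finite S\<close> finite_slope_roots zero_notin_slope_roots
      by (intro card_insert_disjoint) auto
    moreover have "card (\<Union>s\<in>S. slope_roots w s) = (\<Sum>s\<in>S. card (slope_roots w s))"
      using w \<open>finite S\<close> finite_slope_roots slope_roots_disjoint
      by (intro card_UN_disjoint) auto
    ultimately show False
      using n w by (simp add: card_slope_roots)
  qed
  \<comment> \<open>For fixed \<open>i\<close>, \<open>c w i\<close> is a polynomial in
    \<open>w\<close> with coefficients \<open>f (i, j)\<close>; a nonzero one could not vanish at
    every \<open>w > 1\<close>.\<close>
  have "f (i, j) = 0" if "i \<le> n" "j \<le> m" for i j
  proof (rule ccontr)
    assume "f (i, j) \<noteq> 0"
    then have "finite {w. c w i = 0}"
      using polyfun_rootbound[of "\<lambda>j. f (i, j)" j m] that by (simp add: c_def)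
    moreover have "{1<..} \<subseteq> {w. c w i = 0}" using c0 that by auto
    ultimately show False using infinite_Ioi finite_subset by blast
  qed
  then show ?thesis using outside[of p] by (cases p) (auto simp: grid_def)
qed

subsection \<open>The slopes of the puzzle\<close>

primrec finite_slopes :: "nat \<Rightarrow> rat set" where
  "finite_slopes 0 = {0}"
| "finite_slopes (Suc q) =
    {of_nat (Suc q), - of_nat (Suc q), 1 / of_nat (Suc q), - (1 / of_nat (Suc q))} \<union> finite_slopes q"

lemma finite_finite_slopes: "finite (finite_slopes q)"
  by (induction q) auto

lemma finite_slopes_in_slopes_upto: "s \<in> finite_slopes q \<Longrightarrow> Finite_Slope s \<in> slopes_upto q"
proof (induction q)
  case (Suc q)
  have "slopes_upto q \<subseteq> slopes_upto (Suc q)"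
    unfolding slopes_upto_def by (intro Un_mono UN_mono) auto
  moreover have "Finite_Slope s \<in> slopes_upto (Suc q)" if "s \<notin> finite_slopes q"
    using that Suc.prems unfolding slopes_upto_def
    by (intro UnI2 UN_I[of "Suc q"]) (auto simp del: of_nat_Suc)
  ultimately show ?case using Suc.IH by blast
qed (simp add: slopes_upto_def)

text \<open>Nonzero slopes have modulus between \<open>1 / q\<close> and \<open>q\<close>, so the
  four slopes added for \<open>Suc q\<close> are new. The lower bound is multiplied out to make
  sense for \<open>q = 0\<close> as well.\<close>

lemma finite_slopes_bounds:
  "s \<in> finite_slopes q \<Longrightarrow> \<bar>s\<bar> \<le> of_nat q \<and> (s = 0 \<or> 1 \<le> of_nat q * \<bar>s\<bar>)"
proof (induction q)
  case (Suc q)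
  show ?case
  proof (cases "s \<in> finite_slopes q")
    case True
    then show ?thesis using Suc.IH by (fastforce simp: algebra_simps)
  next
    case False
    let ?k = "rat_of_nat (Suc q)"
    have k: "?k \<ge> 1" by simp
    then have "1 / ?k \<le> 1" "?k * ?k \<ge> 1 * 1" by (simp, intro mult_mono) auto
    moreover have "\<bar>s\<bar> = ?k \<or> \<bar>s\<bar> = 1 / ?k"
      using False Suc.prems by (auto simp del: of_nat_Suc)
    moreover have "1 / ?k \<le> ?k" using k \<open>1 / ?k \<le> 1\<close> by linarith
    ultimately show ?thesis by (auto simp del: of_nat_Suc)
  qed
qed simp

text \<open>Passing from \<open>q\<close> to \<open>q + 1\<close> adds the denominators 1, 1,
  \<open>q + 1\<close>, \<open>q + 1\<close>, and \<open>2 * q + 4\<close> is also the increment of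
  the right-hand side.\<close>

lemma sum_denom_finite_slopes:
  assumes "q \<ge> 1"
  shows "(\<Sum>s\<in>finite_slopes q. denom s) = q\<^sup>2 + 3 * q - 1"
  using assms
proof (induction q rule: dec_induct)
  \<comment> \<open>For \<open>q = 1\<close> the integers coincide with their reciprocals, so there
    are three slopes rather than five; hence the induction starts here and not at 0.\<close>
  case base
  have "denom 0 = 1" "denom 1 = 1" "denom (-1) = 1"
    using denom_eqI[of 0 0 1] denom_eqI[of 1 1 1] denom_eqI[of "-1" "-1" 1] by auto
  moreover have "finite_slopes 1 = {0, 1, - 1}" by auto
  ultimately show ?case by (simp add: numeral_eq_Suc)
next
  case (step q)
  let ?k = "rat_of_nat (Suc q)"
  have k: "?k > 1" using step by simp
  have new: "{?k, - ?k, 1 / ?k, - (1 / ?k)} \<inter> finite_slopes q = {}"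
  proof -
    have "x \<notin> finite_slopes q" if "\<bar>x\<bar> = ?k \<or> \<bar>x\<bar> = 1 / ?k" for x
    proof
      assume "x \<in> finite_slopes q"
      then have x: "\<bar>x\<bar> \<le> of_nat q" "x = 0 \<or> 1 \<le> of_nat q * \<bar>x\<bar>"
        using finite_slopes_bounds by auto
      \<comment> \<open>The case \<open>\<bar>x\<bar> = ?k\<close> contradicts
        \<open>\<bar>x\<bar> \<le> q\<close>. In the other case \<open>x \<noteq> 0\<close> and
        \<open>(q + 1) * \<bar>x\<bar> = 1\<close> force \<open>q * \<bar>x\<bar> < 1\<close>,
        against the lower bound.\<close>
      from that have "?k * \<bar>x\<bar> = 1"
      proof
        assume "\<bar>x\<bar> = 1 / ?k"
        then show ?thesis by simp
      qed (use x in simp)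
      then have "of_nat q * \<bar>x\<bar> + \<bar>x\<bar> = 1" by (simp add: algebra_simps)
      moreover have "x \<noteq> 0" using calculation by auto
      ultimately show False using x by linarith
    qed
    with k show ?thesis by auto
  qed
  have "1 / ?k < 1" using k by simp
  moreover have "1 / ?k > 0" by simp
  ultimately have distinct: "?k \<noteq> - ?k" "?k \<noteq> 1 / ?k" "?k \<noteq> - (1 / ?k)"
    "- ?k \<noteq> 1 / ?k" "- ?k \<noteq> - (1 / ?k)" "1 / ?k \<noteq> - (1 / ?k)"
    using k by linarith+
  have "denom ?k = 1" "denom (- ?k) = 1" "denom (1 / ?k) = Suc q" "denom (- (1 / ?k)) = Suc q"
    using denom_eqI[of ?k "int (Suc q)" 1] denom_eqI[of "- ?k" "- int (Suc q)" 1]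
      denom_eqI[of "1 / ?k" 1 "Suc q"] denom_eqI[of "- (1 / ?k)" "- 1" "Suc q"] by auto
  with distinct have "(\<Sum>s\<in>{?k, - ?k, 1 / ?k, - (1 / ?k)}. denom s) = 2 * q + 4"
    by (simp del: of_nat_Suc)
  then have "(\<Sum>s\<in>finite_slopes (Suc q). denom s) = 2 * q + 4 + (q\<^sup>2 + 3 * q - 1)"
    using new step.IH finite_finite_slopes[of q]
    by (simp add: sum.union_disjoint del: of_nat_Suc Un_insert_left)
  then show ?case using step by (simp add: power2_eq_square)
qed

section \<open>From puzzle solutions to vanishing line sums\<close>

text \<open>If the line with intercept \<open>b\<close> meets the grid, both solutions satisfy the
  same clue on it; otherwise the sum is empty.\<close>

lemma rk_solution_line_sum:
  assumes "rk_solution n m T c X" "rk_solution n m T c Y" and s: "Finite_Slope s \<in> T"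
  shows "(\<Sum>p | p \<in> grid n m \<and> rat_of_nat (snd p) - s * of_nat (fst p) = b. X p - Y p) = 0"
proof -
  define l :: "(real \<times> real) set" where "l = {(x, y). y = of_rat s * x + of_rat b}"
  have "lattice_point p \<in> l \<longleftrightarrow> rat_of_nat (snd p) - s * of_nat (fst p) = b" for p
  proof -
    have "lattice_point p \<in> l \<longleftrightarrow>
        real_of_rat (of_nat (snd p)) = of_rat (s * of_nat (fst p) + b)"
      by (simp add: l_def lattice_point_def of_rat_add of_rat_mult)
    also have "\<dots> \<longleftrightarrow> rat_of_nat (snd p) - s * of_nat (fst p) = b"
      by (simp only: of_rat_eq_iff) (auto simp: algebra_simps)
    finally show ?thesis .
  qed
  then have "(\<Sum>p | p \<in> grid n m \<and> rat_of_nat (snd p) - s * of_nat (fst p) = b. X p - Y p)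
      = clue_poly n m l X - clue_poly n m l Y"
    by (simp add: clue_poly_def sum_subtractf)
  also have "\<dots> = 0"
  proof (cases "l \<inter> lattice_point ` grid n m = {}")
    case True
    then have "{p. p \<in> grid n m \<and> lattice_point p \<in> l} = {}" by blast
    then show ?thesis unfolding clue_poly_def by (simp only: sum.empty)
  next
    case False
    moreover have "l \<in> lines_of_slope (Finite_Slope s)"
      unfolding lines_of_slope.simps l_def by blast
    ultimately have "l \<in> grid_lines n m (Finite_Slope s)"
      unfolding grid_lines_def by blast
    then have "clue_poly n m l X = c (Finite_Slope s) l" "clue_poly n m l Y = c (Finite_Slope s) l"
      using assms unfolding rk_solution_def by blast+
    then show ?thesis by (simp only: diff_self)
  qed
  finally show ?thesis .
qed

theorem theorem1:
  fixes q n :: nat and c :: "slope \<Rightarrow> (real \<times> real) set \<Rightarrow> real"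
  assumes "q \<ge> 1" and "n \<ge> 1" and "n \<le> q\<^sup>2 + 3 * q - 1"
    and "rk_solvable n n (slopes_upto q) c"
  shows "\<exists>!X. rk_solution n n (slopes_upto q) c X"
proof (rule ex_ex1I)
  show "\<exists>X. rk_solution n n (slopes_upto q) c X"
    using assms(4) by (simp add: rk_solvable_def)
next
  fix X Y
  assume X: "rk_solution n n (slopes_upto q) c X" and Y: "rk_solution n n (slopes_upto q) c Y"
  let ?f = "\<lambda>p. if p \<in> grid n n then X p - Y p else 0"
  have "?f p = 0" for p
  proof (rule line_sums_zero_imp_zero[where S = "finite_slopes q" and n = n and m = n])
    show "n \<le> (\<Sum>s\<in>finite_slopes q. denom s)"
      using assms by (simp add: sum_denom_finite_slopes)
    show "(\<Sum>p | p \<in> grid n n \<and> rat_of_nat (snd p) - s * of_nat (fst p) = b. ?f p) = 0"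
      if "s \<in> finite_slopes q" for s b
      using rk_solution_line_sum[OF X Y finite_slopes_in_slopes_upto[OF that], of b]
      by (simp cong: conj_cong)
  qed (auto simp: finite_finite_slopes)
  then have "X p = Y p" if "p \<in> grid n n" for p
    using that by (metis eq_iff_diff_eq_0)
  then show "X = Y"
    using X Y unfolding rk_solution_def by (blast intro: PiE_ext)
qed

end
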